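(* Let $E$ be a locale and $\mu$ a (bounded) measure on $E$, extended to all sublocales of $E$ by $\mu(X)=\inf\{\mu(V) : V\text{ open},\ X\subset V\}$. For every increasing sequence $(X_n)_{n\in\mathbb N}$ of sublocales of $E$, $$\mu\Big(\bigcup_n X_n\Big)=\sup_n\mu(X_n).$$
   Context: A locale $E$ is given by a partially ordered set $(O(E),\subset)$, whose elements are called opens, with a least element $\emptyset$ and a greatest element $1_E$ (also written $E$), in which every family $(V_i)$ has a supremum $\bigcup_i V_i$, every pair has an infimum $U\cap V$, and $W\cap\bigcup_i V_i=\bigcup_i (W\cap V_i)$. A sublocale $X$ of $E$ is given by a map $e_X:O(E)\to O(E)$ (its projector) that is increasing, idempotent, and satisfies $U\subset e_X(U)$ and $e_X(U\cap V)=e_X(U)\cap e_X(V)$ for all $U,V\in O(E)$. For sublocales, $X\subset Y$ means $e_X(H)\supset e_Y(H)$ for all $H\in O(E)$. Ordered by inclusion, the sublocales of $E$ form a complete lattice; $\bigcup$ of sublocales denotes the supremum in it. An open $U\in O(E)$ is identified with the open sublocale whose projector is $e_U(H)=$ the largest open $W$ with $W\cap U\subset H$. A (bounded) measure on $E$ is a map $\mu:O(E)\to\mathbb R^+=[0,\infty)$ with $\mu(\emptyset)=0$; $U\subset V\Rightarrow\mu(U)\le\mu(V)$; $\mu(U\cup V)=\mu(U)+\mu(V)-\mu(U\cap V)$; and $\mu(\bigcup_i V_i)=\sup_i\mu(V_i)$ for every upward directed family $(V_i)$ of opens. *)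

theory Defs
  imports Complex_Main
begin

text \<open>
  A locale \<open>E\<close> is represented by its frame of opens \<open>O(E)\<close>, a type of class \<open>frame\<close>; the order
  \<open>\<le>\<close> is the inclusion of opens, \<open>bot\<close> is the empty open and \<open>top\<close> is \<open>1\<^sub>E\<close>.  The library class
  \<open>complete_distrib_lattice\<close> is strictly stronger (complete distributivity) and excludes most locales.
\<close>

class frame = complete_lattice +
  assumes inf_Sup_frame: "inf W (Sup A) = (SUP V\<in>A. inf W V)"

definition is_projector :: "('a::frame \<Rightarrow> 'a) \<Rightarrow> bool" where
  "is_projector e \<longleftrightarrow>
     mono e \<and> (\<forall>U. e (e U) = e U) \<and> (\<forall>U. U \<le> e U) \<and> (\<forall>U V. e (inf U V) = inf (e U) (e V))"

typedef (overloaded) 'a subloc = "{e :: 'a::frame \<Rightarrow> 'a. is_projector e}"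
  morphisms projector Abs_subloc
proof
  show "id \<in> {e. is_projector e}" by (simp add: is_projector_def mono_def)
qed

lemma is_projector_projector: "is_projector (projector X)"
  using projector by auto

lemma projector_mono: "U \<le> V \<Longrightarrow> projector X U \<le> projector X V"
  and projector_idem [simp]: "projector X (projector X U) = projector X U"
  and projector_ge: "U \<le> projector X U"
  and projector_inf: "projector X (inf U V) = inf (projector X U) (projector X V)"
  using is_projector_projector[of X] by (auto simp: is_projector_def mono_def)

lemma projector_Abs_subloc: "is_projector e \<Longrightarrow> projector (Abs_subloc e) = e"
  by (simp add: Abs_subloc_inverse)

lemma is_projector_INF:
  "is_projector (\<lambda>H. INF X\<in>A. projector X H)"
proof -
  have mon: "mono (\<lambda>H. INF X\<in>A. projector X H)"
    by (intro monoI INF_mono) (blast intro: projector_mono)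
  moreover have ge: "U \<le> (INF X\<in>A. projector X U)" for U
    by (intro INF_greatest projector_ge)
  moreover have "(INF X\<in>A. projector X (INF Y\<in>A. projector Y U)) = (INF X\<in>A. projector X U)" for U
  proof (rule antisym)
    show "(INF X\<in>A. projector X (INF Y\<in>A. projector Y U)) \<le> (INF X\<in>A. projector X U)"
    proof (rule INF_mono)
      fix X assume X: "X \<in> A"
      have "projector X (INF Y\<in>A. projector Y U) \<le> projector X (projector X U)"
        using X by (intro projector_mono INF_lower)
      then show "\<exists>Z\<in>A. projector Z (INF Y\<in>A. projector Y U) \<le> projector X U"
        using X by auto
    qed
  qed (rule ge)
  ultimately show ?thesis
    by (simp add: is_projector_def projector_inf INF_inf_distrib)
qed

text \<open>
  Inclusion of sublocales reverses the pointwise order of projectors.  The supremum of a set of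
  sublocales has the pointwise infimum as projector; that these operations are the supremum and
  infimum for inclusion is the content of the class instance.
\<close>

instantiation subloc :: (frame) complete_lattice
begin

definition less_eq_subloc :: "'a subloc \<Rightarrow> 'a subloc \<Rightarrow> bool" where
  "X \<le> Y \<longleftrightarrow> (\<forall>H. projector Y H \<le> projector X H)"

definition less_subloc :: "'a subloc \<Rightarrow> 'a subloc \<Rightarrow> bool" where
  "X < Y \<longleftrightarrow> X \<le> Y \<and> \<not> Y \<le> X" for X Y :: "'a subloc"

definition Sup_subloc :: "'a subloc set \<Rightarrow> 'a subloc" where
  "Sup A = Abs_subloc (\<lambda>H. INF X\<in>A. projector X H)"

definition Inf_subloc :: "'a subloc set \<Rightarrow> 'a subloc" where
  "Inf A = Sup {X. \<forall>Y\<in>A. X \<le> Y}" for A :: "'a subloc set"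

definition sup_subloc :: "'a subloc \<Rightarrow> 'a subloc \<Rightarrow> 'a subloc" where
  "sup X Y = Sup {X, Y}" for X Y :: "'a subloc"

definition inf_subloc :: "'a subloc \<Rightarrow> 'a subloc \<Rightarrow> 'a subloc" where
  "inf X Y = Inf {X, Y}" for X Y :: "'a subloc"

definition bot_subloc :: "'a subloc" where
  "bot = (Sup {} :: 'a subloc)"

definition top_subloc :: "'a subloc" where
  "top = (Inf {} :: 'a subloc)"

instance
proof -
  have Sup_upper': "X \<le> Sup A" if "X \<in> A" for X :: "'a subloc" and A
    using that
    by (auto simp: less_eq_subloc_def Sup_subloc_def projector_Abs_subloc is_projector_INF
        intro: INF_lower)
  have Sup_least': "Sup A \<le> Z" if "\<And>X. X \<in> A \<Longrightarrow> X \<le> Z" for Z :: "'a subloc" and A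
    using that
    by (auto simp: less_eq_subloc_def Sup_subloc_def projector_Abs_subloc is_projector_INF
        intro!: INF_greatest)
  have Inf_lower': "Inf A \<le> X" if "X \<in> A" for X :: "'a subloc" and A
    unfolding Inf_subloc_def using that by (blast intro: Sup_least')
  have Inf_greatest': "Z \<le> Inf A" if "\<And>X. X \<in> A \<Longrightarrow> Z \<le> X" for Z :: "'a subloc" and A
    unfolding Inf_subloc_def using that by (blast intro: Sup_upper')
  show "OFCLASS('a subloc, complete_lattice_class)"
  proof
    fix X Y Z :: "'a subloc" and A :: "'a subloc set"
    show "X < Y \<longleftrightarrow> X \<le> Y \<and> \<not> Y \<le> X" by (rule less_subloc_def)
    show "X \<le> X" by (simp add: less_eq_subloc_def)
    show "X \<le> Z" if "X \<le> Y" "Y \<le> Z"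
      using that by (auto simp: less_eq_subloc_def intro: order_trans)
    show "X = Y" if "X \<le> Y" "Y \<le> X"
      using that by (intro projector_inject[THEN iffD1] ext antisym)
        (auto simp: less_eq_subloc_def)
    show "inf X Y \<le> X" "inf X Y \<le> Y" unfolding inf_subloc_def by (auto intro: Inf_lower')
    show "X \<le> inf Y Z" if "X \<le> Y" "X \<le> Z"
      unfolding inf_subloc_def using that by (auto intro: Inf_greatest')
    show "X \<le> sup X Y" "Y \<le> sup X Y" unfolding sup_subloc_def by (auto intro: Sup_upper')
    show "sup Y Z \<le> X" if "Y \<le> X" "Z \<le> X"
      unfolding sup_subloc_def using that by (auto intro: Sup_least')
    show "Inf A \<le> X" if "X \<in> A" using that by (rule Inf_lower')
    show "Z \<le> Inf A" if "\<And>X. X \<in> A \<Longrightarrow> Z \<le> X" using that by (rule Inf_greatest')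
    show "X \<le> Sup A" if "X \<in> A" using that by (rule Sup_upper')
    show "Sup A \<le> Z" if "\<And>X. X \<in> A \<Longrightarrow> X \<le> Z" using that by (rule Sup_least')
    show "Inf {} = (top :: 'a subloc)" "Sup {} = (bot :: 'a subloc)"
      by (simp_all add: top_subloc_def bot_subloc_def)
  qed
qed

end

definition open_projector :: "'a::frame \<Rightarrow> 'a \<Rightarrow> 'a" where
  "open_projector U H = Sup {W. inf W U \<le> H}"

lemma le_open_projector_iff: "W \<le> open_projector U H \<longleftrightarrow> inf W U \<le> H"
proof
  assume "W \<le> open_projector U H"
  then have "inf W U \<le> inf U (open_projector U H)"
    by (simp add: le_infI1 le_infI2)
  also have "\<dots> = (SUP W\<in>{W. inf W U \<le> H}. inf U W)"
    by (simp add: open_projector_def inf_Sup_frame)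
  also have "\<dots> \<le> H"
    by (rule SUP_least) (simp add: inf_commute)
  finally show "inf W U \<le> H" .
qed (simp add: open_projector_def Sup_upper)

lemma open_projector_greatest:
  "inf (open_projector U H) U \<le> H"
  "inf W U \<le> H \<Longrightarrow> W \<le> open_projector U H"
  using le_open_projector_iff[of "open_projector U H" U H]
  by (simp_all add: le_open_projector_iff)

lemma is_projector_open_projector: "is_projector (open_projector U)"
  unfolding is_projector_def
proof (intro conjI allI)
  have *: "open_projector U H = open_projector U H'"
    if "\<And>W. inf W U \<le> H \<longleftrightarrow> inf W U \<le> H'" for H H'
    using that by (simp add: open_projector_def)
  show "mono (open_projector U)"
    by (rule monoI) (metis le_open_projector_iff order_refl order_trans)
  show "open_projector U (open_projector U H) = open_projector U H" for H
    by (rule *) (simp add: le_open_projector_iff inf_assoc)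
  show "H \<le> open_projector U H" for H
    by (simp add: le_open_projector_iff)
  show "open_projector U (inf H K) = inf (open_projector U H) (open_projector U K)" for H K
    by (rule antisym) (metis le_inf_iff le_open_projector_iff order_refl)+
qed

definition open_subloc :: "'a::frame \<Rightarrow> 'a subloc" where
  "open_subloc U = Abs_subloc (open_projector U)"

lemma projector_open_subloc: "projector (open_subloc U) = open_projector U"
  by (simp add: open_subloc_def projector_Abs_subloc is_projector_open_projector)

lemma open_subloc_le_iff [simp]: "open_subloc U \<le> open_subloc V \<longleftrightarrow> U \<le> V"
proof
  assume "open_subloc U \<le> open_subloc V"
  then have "open_projector V V \<le> open_projector U V"
    by (simp add: less_eq_subloc_def projector_open_subloc)
  moreover have "top \<le> open_projector V V"
    by (simp add: le_open_projector_iff)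
  ultimately have "top \<le> open_projector U V"
    by (rule order_trans[rotated])
  then show "U \<le> V"
    by (simp add: le_open_projector_iff)
next
  assume "U \<le> V"
  then have "inf W V \<le> H \<Longrightarrow> inf W U \<le> H" for W H
    by (meson inf_mono order_refl order_trans)
  then show "open_subloc U \<le> open_subloc V"
    by (auto simp: less_eq_subloc_def projector_open_subloc open_projector_def
        intro!: Sup_subset_mono)
qed

lemma le_open_subloc_top [simp]: "X \<le> open_subloc top"
  by (simp add: less_eq_subloc_def projector_open_subloc open_projector_def)
    (auto intro!: Sup_least intro: order_trans projector_ge)

definition directed_up :: "'a::order set \<Rightarrow> bool" where
  "directed_up D \<longleftrightarrow> D \<noteq> {} \<and> (\<forall>U\<in>D. \<forall>V\<in>D. \<exists>W\<in>D. U \<le> W \<and> V \<le> W)"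

text \<open>
  Directed families are nonempty, as the real supremum of the empty set is unspecified; in
  \<open>[0,\<infinity>)\<close> that supremum is \<open>0\<close>, so the empty family would only repeat \<open>measure_bot\<close>.
\<close>

locale locale_measure =
  fixes \<mu> :: "'a::frame \<Rightarrow> real"
  assumes measure_nonneg: "0 \<le> \<mu> U"
    and measure_bot: "\<mu> bot = 0"
    and measure_mono: "U \<le> V \<Longrightarrow> \<mu> U \<le> \<mu> V"
    and measure_sup: "\<mu> (sup U V) = \<mu> U + \<mu> V - \<mu> (inf U V)"
    and measure_directed: "directed_up D \<Longrightarrow> \<mu> (Sup D) = (SUP V\<in>D. \<mu> V)"

definition measure_ext :: "('a::frame \<Rightarrow> real) \<Rightarrow> 'a subloc \<Rightarrow> real" where
  "measure_ext \<mu> X = (INF V\<in>{V. X \<le> open_subloc V}. \<mu> V)"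

context locale_measure
begin

lemma bdd_below_measure: "bdd_below (\<mu> ` A)"
  by (rule bdd_belowI[of _ 0]) (auto simp: measure_nonneg)

lemma measure_ext_open: "measure_ext \<mu> (open_subloc U) = \<mu> U"
  unfolding measure_ext_def
  by (rule cInf_eq_minimum) (auto intro: measure_mono)

lemma measure_ext_le: "X \<le> open_subloc V \<Longrightarrow> measure_ext \<mu> X \<le> \<mu> V"
  unfolding measure_ext_def by (rule cINF_lower) (auto simp: bdd_below_measure)

text \<open>So suprema of values of \<open>measure_ext \<mu>\<close> over nonempty sets are genuine suprema in the reals.\<close>

lemma bdd_above_measure_ext: "bdd_above (measure_ext \<mu> ` A)"
  by (rule bdd_aboveI[of _ "\<mu> top"]) (auto intro: measure_ext_le)

end

end

theory Submission
  imports Defs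
begin

text \<open>
  As for outer measures on a space, the inequality \<open>\<le>\<close> is the one with content.  Given
  \<open>\<epsilon> > 0\<close>, enclose each \<open>X\<^sub>n\<close> in an open \<open>V\<^sub>n\<close> whose measure exceeds that of \<open>X\<^sub>n\<close> by at most
  \<open>\<epsilon> / 2\<^bsup>n+1\<^esup>\<close>, and put \<open>W\<^sub>n = V\<^sub>0 \<union> \<dots> \<union> V\<^sub>n\<close>.  The excesses merely add up, so that
  \<open>\<mu>(W\<^sub>n) \<le> \<mu>(X\<^sub>n) + \<epsilon>\<close>: the opens \<open>W\<^sub>n\<close> and \<open>V\<^sub>n\<^sub>+\<^sub>1\<close> both contain \<open>X\<^sub>n\<close>, hence so does their
  intersection (\<open>subloc_le_open_inf\<close>), and modularity of \<open>\<mu>\<close> bounds the measure of their union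
  by \<open>\<mu>(W\<^sub>n) + \<mu>(V\<^sub>n\<^sub>+\<^sub>1) - \<mu>(X\<^sub>n)\<close> (\<open>measure_sup_le\<close>).  The union of the \<open>W\<^sub>n\<close> is an open
  containing every \<open>X\<^sub>n\<close>, hence their supremum, and continuity of \<open>\<mu>\<close> along this directed union
  bounds its measure by \<open>sup\<^sub>n \<mu>(X\<^sub>n) + \<epsilon>\<close>.

  The localic input is that the opens containing a given sublocale are closed under finite
  intersection; it comes from projectors preserving intersections.
\<close>

text \<open>
  The projector of \<open>X\<close> sends an open to the largest open with the same trace on \<open>X\<close>, so
  \<open>X\<close> lies in \<open>U\<close> exactly when \<open>U\<close> has the trace of the whole locale.
\<close>

lemma subloc_le_open_iff: "X \<le> open_subloc U \<longleftrightarrow> projector X U = top"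
proof
  assume "X \<le> open_subloc U"
  then have "open_projector U U \<le> projector X U"
    by (simp add: less_eq_subloc_def projector_open_subloc)
  moreover have "top \<le> open_projector U U"
    by (simp add: le_open_projector_iff)
  ultimately show "projector X U = top"
    by (simp add: top_unique)
next
  assume top: "projector X U = top"
  have "open_projector U H \<le> projector X H" for H
  proof -
    have "open_projector U H \<le> projector X (open_projector U H)"
      by (rule projector_ge)
    also have "\<dots> = projector X (inf (open_projector U H) U)"
      by (simp add: projector_inf top)
    also have "\<dots> \<le> projector X H"
      by (intro projector_mono open_projector_greatest)
    finally show ?thesis .
  qed
  then show "X \<le> open_subloc U"
    by (simp add: less_eq_subloc_def projector_open_subloc)
qed

lemma subloc_le_open_inf:
  "X \<le> open_subloc U \<Longrightarrow> X \<le> open_subloc V \<Longrightarrow> X \<le> open_subloc (inf U V)"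
  by (simp add: subloc_le_open_iff projector_inf)

lemma directed_up_range_incseq:
  assumes "incseq W"
  shows "directed_up (range W)"
proof -
  have "W m \<le> W (max m n) \<and> W n \<le> W (max m n)" for m n
    using assms by (simp add: incseqD)
  then show ?thesis
    unfolding directed_up_def by blast
qed

context locale_measure
begin

lemma measure_ext_mono:
  assumes "X \<le> Y"
  shows "measure_ext \<mu> X \<le> measure_ext \<mu> Y"
  unfolding measure_ext_def
proof (rule cINF_superset_mono)
  show "{V. Y \<le> open_subloc V} \<noteq> {}"
    using le_open_subloc_top by blast
  show "{V. Y \<le> open_subloc V} \<subseteq> {V. X \<le> open_subloc V}"
    using order_trans[OF assms] by blast
qed (simp_all add: bdd_below_measure)

lemma open_neighbourhood_approx:
  assumes "0 < \<epsilon>"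
  obtains V where "X \<le> open_subloc V" "\<mu> V \<le> measure_ext \<mu> X + \<epsilon>"
proof -
  have "Inf (\<mu> ` {V. X \<le> open_subloc V}) < measure_ext \<mu> X + \<epsilon>"
    using assms by (simp add: measure_ext_def)
  moreover have "\<mu> ` {V. X \<le> open_subloc V} \<noteq> {}"
    using le_open_subloc_top by blast
  ultimately obtain r where "r \<in> \<mu> ` {V. X \<le> open_subloc V}" "r < measure_ext \<mu> X + \<epsilon>"
    using cInf_lessD[of "\<mu> ` {V. X \<le> open_subloc V}" "measure_ext \<mu> X + \<epsilon>"] by metis
  then obtain V where "X \<le> open_subloc V" "\<mu> V < measure_ext \<mu> X + \<epsilon>"
    by blast
  then show thesis
    by (simp add: that)
qed

text \<open>
  Strong subadditivity: the common part of two opens around \<open>X\<close> is counted only once, and it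
  has at least the measure of \<open>X\<close>.
\<close>

lemma measure_sup_le:
  assumes "X \<le> open_subloc U" "X \<le> open_subloc V"
  shows "\<mu> (sup U V) \<le> \<mu> U + \<mu> V - measure_ext \<mu> X"
  using measure_ext_le[OF subloc_le_open_inf[OF assms]] by (simp add: measure_sup)

text \<open>
  In the step from \<open>n\<close> to \<open>n + 1\<close> the term \<open>\<mu>(X\<^sub>n)\<close> subtracted by strong subadditivity cancels the
  one in the induction hypothesis, so that only the excesses accumulate.
\<close>

lemma measure_partial_SUP_le:
  fixes X :: "nat \<Rightarrow> 'a subloc" and \<delta> :: "nat \<Rightarrow> real"
  assumes "incseq X"
    and le: "\<And>n. X n \<le> open_subloc (V n)"
    and excess: "\<And>n. \<mu> (V n) \<le> measure_ext \<mu> (X n) + \<delta> n"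
  shows "\<mu> (SUP k\<in>{..n}. V k) \<le> measure_ext \<mu> (X n) + (\<Sum>k\<le>n. \<delta> k)"
proof (induction n)
  case 0
  show ?case using excess[of 0] by simp
next
  case (Suc n)
  let ?W = "SUP k\<in>{..n}. V k"
  have "open_subloc (V n) \<le> open_subloc ?W"
    by (auto intro: SUP_upper)
  then have "X n \<le> open_subloc ?W"
    by (rule order_trans[OF le])
  moreover have "X n \<le> open_subloc (V (Suc n))"
    using incseq_SucD[OF \<open>incseq X\<close>] le by (rule order_trans)
  ultimately have "\<mu> (sup ?W (V (Suc n))) \<le> \<mu> ?W + \<mu> (V (Suc n)) - measure_ext \<mu> (X n)"
    by (rule measure_sup_le)
  also have "\<dots> \<le> measure_ext \<mu> (X (Suc n)) + (\<Sum>k\<le>Suc n. \<delta> k)"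
    using Suc.IH excess[of "Suc n"] by simp
  finally show ?case
    by (simp add: atMost_Suc sup_commute)
qed

lemma measure_ext_SUP_le:
  fixes X :: "nat \<Rightarrow> 'a subloc"
  assumes X: "incseq X" and "0 < \<epsilon>"
  shows "measure_ext \<mu> (SUP n. X n) \<le> (SUP n. measure_ext \<mu> (X n)) + \<epsilon>"
proof -
  define \<delta> :: "nat \<Rightarrow> real" where "\<delta> n = \<epsilon> * (1 / 2) ^ Suc n" for n
  have sum_\<delta>: "(\<Sum>k\<le>n. \<delta> k) \<le> \<epsilon>" for n
  proof -
    have "(\<Sum>k\<le>n. \<delta> k) = \<epsilon> * (1 - (1 / 2) ^ Suc n)"
      by (induction n) (simp_all add: \<delta>_def algebra_simps)
    also have "\<dots> \<le> \<epsilon>"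
      using \<open>0 < \<epsilon>\<close> by (simp add: mult_le_cancel_left1)
    finally show ?thesis .
  qed
  have "\<exists>V. X n \<le> open_subloc V \<and> \<mu> V \<le> measure_ext \<mu> (X n) + \<delta> n" for n
    using open_neighbourhood_approx[of "\<delta> n" "X n"] \<open>0 < \<epsilon>\<close> by (auto simp: \<delta>_def)
  then obtain V where V: "\<And>n. X n \<le> open_subloc (V n)"
      and excess: "\<And>n. \<mu> (V n) \<le> measure_ext \<mu> (X n) + \<delta> n"
    by metis
  define W where "W n = (SUP k\<in>{..n}. V k)" for n
  have W: "incseq W"
    unfolding W_def by (intro monoI SUP_subset_mono) auto
  have "X n \<le> open_subloc (Sup (range W))" for n
  proof -
    have "V n \<le> W n"
      unfolding W_def by (rule SUP_upper) simp
    also have "\<dots> \<le> Sup (range W)"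
      by (rule Sup_upper) simp
    finally show ?thesis
      by (intro order_trans[OF V]) simp
  qed
  then have "(SUP n. X n) \<le> open_subloc (Sup (range W))"
    by (rule SUP_least)
  then have "measure_ext \<mu> (SUP n. X n) \<le> \<mu> (Sup (range W))"
    by (rule measure_ext_le)
  also have "\<dots> = (SUP n. \<mu> (W n))"
    by (simp add: measure_directed directed_up_range_incseq W image_image)
  also have "\<dots> \<le> (SUP n. measure_ext \<mu> (X n)) + \<epsilon>"
  proof (rule cSUP_least)
    fix n
    have "\<mu> (W n) \<le> measure_ext \<mu> (X n) + \<epsilon>"
      using measure_partial_SUP_le[OF X V excess, of n] sum_\<delta>[of n] by (simp add: W_def)
    moreover have "measure_ext \<mu> (X n) \<le> (SUP n. measure_ext \<mu> (X n))"
      using bdd_above_measure_ext[of "range X"] by (intro cSUP_upper) (auto simp: image_image)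
    ultimately show "\<mu> (W n) \<le> (SUP n. measure_ext \<mu> (X n)) + \<epsilon>"
      by simp
  qed simp
  finally show ?thesis .
qed

end

theorem mainTheorem2:
  fixes \<mu> :: "'a::frame \<Rightarrow> real" and X :: "nat \<Rightarrow> 'a subloc"
  assumes "locale_measure \<mu>"
    and "incseq X"
  shows "measure_ext \<mu> (SUP n. X n) = (SUP n. measure_ext \<mu> (X n))"
proof -
  interpret locale_measure \<mu> by fact
  show ?thesis
  proof (rule antisym)
    show "measure_ext \<mu> (SUP n. X n) \<le> (SUP n. measure_ext \<mu> (X n))"
      by (rule field_le_epsilon) (rule measure_ext_SUP_le[OF \<open>incseq X\<close>])
    show "(SUP n. measure_ext \<mu> (X n)) \<le> measure_ext \<mu> (SUP n. X n)"
      by (intro cSUP_least measure_ext_mono SUP_upper) simp_all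
  qed
qed

end
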